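(* (Independent implementability.) For all WMTS $S_1,S_2,S_3,S_4$ we have $d_m(S_1\| S_3,\,S_2\| S_4)\le d_m(S_1,S_2)+d_m(S_3,S_4)$.
   Context: Fix a finite set $\Sigma$ of actions and a real discounting factor $\lambda$ with $0<\lambda<1$. Let $\mathbb I=\{[x,y] : x\in\mathbb Z\cup\{-\infty\},\ y\in\mathbb Z\cup\{\infty\},\ x\le y\}$ and $\mathbb K=\Sigma\times\mathbb I$. Order $\mathbb I$ by $[x,y]\sqsubseteq[x',y']$ iff $x'\le x$, $y\le y'$, and $\mathbb K$ by $(a,I)\sqsubseteq(a',I')$ iff $a=a'$, $I\sqsubseteq I'$. A WMTS $S=(S,s^0,\dashrightarrow,\longrightarrow)$ consists of a set of states $S$, initial state $s^0$, may- and must-relations $\dashrightarrow,\longrightarrow\subseteq S\times\mathbb K\times S$ such that every $(s,k,s')\in\longrightarrow$ has some $(s,\ell,s')\in\dashrightarrow$ with $k\sqsubseteq\ell$. Label distance $d_{\mathbb K}((a_1,I_1),(a_2,I_2))=\infty$ if $a_1\ne a_2$, $d_{\mathbb K}((a,[x_1,y_1]),(a,[x_2,y_2]))=\max(x_2-x_1,y_1-y_2,0)$. Modal refinement distance: least fixed point of $d_m(s_1,s_2)=\max\{\sup_{s_1\overset{k_1}{\dashrightarrow}t_1}\inf_{s_2\overset{k_2}{\dashrightarrow}t_2}(d_{\mathbb K}(k_1,k_2)+\lambda d_m(t_1,t_2)),\ \sup_{s_2\overset{k_2}{\longrightarrow}t_2}\inf_{s_1\overset{k_1}{\longrightarrow}t_1}(d_{\mathbb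 K}(k_1,k_2)+\lambda d_m(t_1,t_2))\}$ ($\sup\emptyset=0$, $\inf\emptyset=\infty$), $d_m(S_1,S_2)=d_m(s_1^0,s_2^0)$. Partial operation $\oplus$ on $\mathbb K$: undefined on $(a_1,I_1),(a_2,I_2)$ if $a_1\ne a_2$, and $(a,[x_1,y_1])\oplus(a,[x_2,y_2])=(a,[x_1+x_2,y_1+y_2])$. The structural composition $S_1\| S_2$ has state set $S_1\times S_2$, initial state $(s_1^0,s_2^0)$, a may-transition $(s_1,s_2)\overset{k_1\oplus k_2}{\dashrightarrow}(t_1,t_2)$ whenever $s_1\overset{k_1}{\dashrightarrow}_1t_1$, $s_2\overset{k_2}{\dashrightarrow}_2t_2$ and $k_1\oplus k_2$ is defined, and a must-transition $(s_1,s_2)\overset{k_1\oplus k_2}{\longrightarrow}(t_1,t_2)$ whenever $s_1\overset{k_1}{\longrightarrow}_1t_1$, $s_2\overset{k_2}{\longrightarrow}_2t_2$ and $k_1\oplus k_2$ is defined (no other transitions). Standing assumption: all WMTS are compactly branching (for each state $s$ the sets $\{(s',k): s\overset{k}{\dashrightarrow}s'\}$, $\{(s',k): s\overset{k}{\longrightarrow}s'\}$ are compact under $((s',k),(s'',k''))\mapsto\bar d_m(s',s'')+\bar d_{\mathbb K}(k,k'')$, $\bar d$ the symmetrization). *)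

theory Defs
  imports "HOL-Analysis.Analysis"
begin

type_synonym ival = "ereal \<times> ereal"
type_synonym 'a label = "'a \<times> ival"

definition intervals :: "ival set" where
  "intervals = {(x, y).
     x \<in> range (\<lambda>n::int. ereal (real_of_int n)) \<union> {-\<infinity>} \<and>
     y \<in> range (\<lambda>n::int. ereal (real_of_int n)) \<union> {\<infinity>} \<and>
     x \<le> y}"

definition labels :: "'a set \<Rightarrow> 'a label set" where
  "labels \<Sigma> = \<Sigma> \<times> intervals"

fun ival_le :: "ival \<Rightarrow> ival \<Rightarrow> bool" where
  "ival_le (x, y) (x', y') \<longleftrightarrow> x' \<le> x \<and> y \<le> y'"

fun label_le :: "'a label \<Rightarrow> 'a label \<Rightarrow> bool" (infix "\<sqsubseteq>\<^sub>K" 50) where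
  "(a, I) \<sqsubseteq>\<^sub>K (a', I') \<longleftrightarrow> a = a' \<and> ival_le I I'"

(* Differences of equal infinite bounds are 0, so that every label has distance 0 to
   itself; subtraction on ereal would give \<infinity> - \<infinity> = \<infinity>. *)
definition bound_diff :: "ereal \<Rightarrow> ereal \<Rightarrow> ereal" where
  "bound_diff u v = (if u = v then 0 else u - v)"

fun label_dist :: "'a label \<Rightarrow> 'a label \<Rightarrow> ennreal" where
  "label_dist (a1, (x1, y1)) (a2, (x2, y2)) =
     (if a1 \<noteq> a2 then \<infinity>
      else e2ennreal (max (max (bound_diff x2 x1) (bound_diff y1 y2)) 0))"

fun label_plus :: "'a label \<Rightarrow> 'a label \<Rightarrow> 'a label option" (infixl "\<oplus>\<^sub>K" 65) where
  "(a1, (x1, y1)) \<oplus>\<^sub>K (a2, (x2, y2)) =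
     (if a1 = a2 then Some (a1, (x1 + x2, y1 + y2)) else None)"

record ('a, 's) wmts =
  states :: "'s set"
  init :: 's
  may :: "('s \<times> 'a label \<times> 's) set"
  must :: "('s \<times> 'a label \<times> 's) set"

definition is_wmts :: "'a set \<Rightarrow> ('a, 's) wmts \<Rightarrow> bool" where
  "is_wmts \<Sigma> S \<longleftrightarrow>
     init S \<in> states S \<and>
     may S \<subseteq> states S \<times> labels \<Sigma> \<times> states S \<and>
     must S \<subseteq> states S \<times> labels \<Sigma> \<times> states S \<and>
     (\<forall>s k s'. (s, k, s') \<in> must S \<longrightarrow> (\<exists>l. (s, l, s') \<in> may S \<and> k \<sqsubseteq>\<^sub>K l))"

(* In ennreal the empty supremum is 0 and the empty infimum is \<infinity>. *)
definition refine_step ::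
  "real \<Rightarrow> ('a, 's) wmts \<Rightarrow> ('a, 't) wmts \<Rightarrow> ('s \<Rightarrow> 't \<Rightarrow> ennreal) \<Rightarrow> ('s \<Rightarrow> 't \<Rightarrow> ennreal)" where
  "refine_step lam S1 S2 d = (\<lambda>s1 s2. max
     (SUP (k1, t1) \<in> {(k, t). (s1, k, t) \<in> may S1}.
        INF (k2, t2) \<in> {(k, t). (s2, k, t) \<in> may S2}.
          label_dist k1 k2 + ennreal lam * d t1 t2)
     (SUP (k2, t2) \<in> {(k, t). (s2, k, t) \<in> must S2}.
        INF (k1, t1) \<in> {(k, t). (s1, k, t) \<in> must S1}.
          label_dist k1 k2 + ennreal lam * d t1 t2))"

definition state_dist ::
  "real \<Rightarrow> ('a, 's) wmts \<Rightarrow> ('a, 't) wmts \<Rightarrow> 's \<Rightarrow> 't \<Rightarrow> ennreal" where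
  "state_dist lam S1 S2 = lfp (refine_step lam S1 S2)"

definition modal_dist :: "real \<Rightarrow> ('a, 's) wmts \<Rightarrow> ('a, 't) wmts \<Rightarrow> ennreal" where
  "modal_dist lam S1 S2 = state_dist lam S1 S2 (init S1) (init S2)"

lemma mono_refine_step:
  fixes S1 :: "('a, 's) wmts" and S2 :: "('a, 't) wmts"
  shows "mono (refine_step lam S1 S2)"
proof (intro monoI le_funI)
  fix d d' :: "'s \<Rightarrow> 't \<Rightarrow> ennreal" and s1 s2
  assume "d \<le> d'"
  then have "label_dist k1 k2 + ennreal lam * d t1 t2 \<le> label_dist k1 k2 + ennreal lam * d' t1 t2"
    for k1 k2 t1 t2
    by (intro add_left_mono mult_left_mono) (auto simp: le_fun_def)
  then show "refine_step lam S1 S2 d s1 s2 \<le> refine_step lam S1 S2 d' s1 s2"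
    unfolding refine_step_def split_beta by (intro max.mono SUP_mono' INF_mono')
qed

lemma state_dist_unfold:
  "refine_step lam S1 S2 (state_dist lam S1 S2) = state_dist lam S1 S2"
  unfolding state_dist_def by (rule lfp_fixpoint[OF mono_refine_step])

definition symmetrize :: "('x \<Rightarrow> 'x \<Rightarrow> ennreal) \<Rightarrow> 'x \<Rightarrow> 'x \<Rightarrow> ennreal" where
  "symmetrize d x y = max (d x y) (d y x)"

(* The topology induced by an extended pseudometric; the distance may be \<infinity> or vanish
   between distinct points, so Metric_space does not apply. *)
definition dist_topology :: "'x set \<Rightarrow> ('x \<Rightarrow> 'x \<Rightarrow> ennreal) \<Rightarrow> 'x topology" where
  "dist_topology A d =
     topology (\<lambda>U. U \<subseteq> A \<and> (\<forall>x\<in>U. \<exists>e>0. \<forall>y\<in>A. d x y < e \<longrightarrow> y \<in> U))"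

lemma openin_dist_topology:
  "openin (dist_topology A d) U \<longleftrightarrow>
     U \<subseteq> A \<and> (\<forall>x\<in>U. \<exists>e>0. \<forall>y\<in>A. d x y < e \<longrightarrow> y \<in> U)"
proof -
  let ?P = "\<lambda>U. U \<subseteq> A \<and> (\<forall>x\<in>U. \<exists>e>0. \<forall>y\<in>A. d x y < e \<longrightarrow> y \<in> U)"
  have "?P (U \<inter> V)" if U: "?P U" and V: "?P V" for U V
  proof (intro conjI ballI)
    show "U \<inter> V \<subseteq> A" using U by blast
    fix x assume x: "x \<in> U \<inter> V"
    obtain e where e: "e > 0" "\<forall>y\<in>A. d x y < e \<longrightarrow> y \<in> U" using U x by blast
    obtain f where f: "f > 0" "\<forall>y\<in>A. d x y < f \<longrightarrow> y \<in> V" using V x by blast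
    have "min e f > 0" "\<forall>y\<in>A. d x y < min e f \<longrightarrow> y \<in> U \<inter> V"
      using e f by auto
    then show "\<exists>e>0. \<forall>y\<in>A. d x y < e \<longrightarrow> y \<in> U \<inter> V" by blast
  qed
  moreover have "?P (\<Union>\<K>)" if fam: "\<forall>K\<in>\<K>. ?P K" for \<K>
  proof (intro conjI ballI)
    show "\<Union>\<K> \<subseteq> A" using fam by blast
    fix x assume "x \<in> \<Union>\<K>"
    then obtain K where K: "K \<in> \<K>" "x \<in> K" by blast
    then obtain e where "e > 0" "\<forall>y\<in>A. d x y < e \<longrightarrow> y \<in> K"
      using fam by meson
    then show "\<exists>e>0. \<forall>y\<in>A. d x y < e \<longrightarrow> y \<in> \<Union>\<K>" using K by blast
  qed
  ultimately have "istopology ?P" unfolding istopology_def by blast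
  then show ?thesis unfolding dist_topology_def by (simp add: topology_inverse')
qed

definition branch_dist ::
  "real \<Rightarrow> ('a, 's) wmts \<Rightarrow> 's \<times> 'a label \<Rightarrow> 's \<times> 'a label \<Rightarrow> ennreal" where
  "branch_dist lam S = (\<lambda>(s', k) (s'', k'').
     symmetrize (state_dist lam S S) s' s'' + symmetrize label_dist k k'')"

definition compactly_branching :: "'a set \<Rightarrow> real \<Rightarrow> ('a, 's) wmts \<Rightarrow> bool" where
  "compactly_branching \<Sigma> lam S \<longleftrightarrow>
     (\<forall>s\<in>states S.
        compactin (dist_topology (states S \<times> labels \<Sigma>) (branch_dist lam S))
          {(s', k). (s, k, s') \<in> may S} \<and>
        compactin (dist_topology (states S \<times> labels \<Sigma>) (branch_dist lam S))
          {(s', k). (s, k, s') \<in> must S})"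

definition structural_comp ::
  "('a, 's) wmts \<Rightarrow> ('a, 't) wmts \<Rightarrow> ('a, 's \<times> 't) wmts" (infixl "\<parallel>" 60) where
  "S1 \<parallel> S2 = \<lparr>
     states = states S1 \<times> states S2,
     init = (init S1, init S2),
     may = {((s1, s2), k, (t1, t2)) | s1 s2 k t1 t2.
       \<exists>k1 k2. (s1, k1, t1) \<in> may S1 \<and> (s2, k2, t2) \<in> may S2 \<and> k1 \<oplus>\<^sub>K k2 = Some k},
     must = {((s1, s2), k, (t1, t2)) | s1 s2 k t1 t2.
       \<exists>k1 k2. (s1, k1, t1) \<in> must S1 \<and> (s2, k2, t2) \<in> must S2 \<and> k1 \<oplus>\<^sub>K k2 = Some k}\<rparr>"

end

theory Submission
  imports Defs
begin

text \<open>The proof is by fixed-point induction: the sum of the distances of the components is a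
  pre-fixed point of the refinement operator of the two compositions. This rests on
  subadditivity of the label distance under \<open>\<oplus>\<^sub>K\<close>, and on the fact that labels at finite
  distance carry the same action, so that near-optimal matches of the components compose.\<close>

section \<open>Sums of infima of extended nonnegative reals\<close>

text \<open>The infima need not be attained, so no optimal pair is chosen: each pair
  \<open>p\<close>, \<open>q\<close> bounds the left side separately, and the infima are then taken
  one after the other. A pair with sum \<open>top\<close> bounds anything, which is why a match
  \<open>r\<close> is demanded only for finite sums.\<close>

lemma INF_le_INF_add_INF:
  fixes f :: "'i \<Rightarrow> ennreal" and g :: "'j \<Rightarrow> ennreal" and h :: "'k \<Rightarrow> ennreal"
  assumes "\<And>p q. p \<in> A \<Longrightarrow> q \<in> B \<Longrightarrow> f p + g q < top \<Longrightarrow> \<exists>r\<in>C. h r \<le> f p + g q"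
  shows "(INF r\<in>C. h r) \<le> (INF p\<in>A. f p) + (INF q\<in>B. g q)"
proof -
  let ?L = "INF r\<in>C. h r"
  have le: "?L \<le> f p + g q" if "p \<in> A" "q \<in> B" for p q
    using assms[OF that] by (cases "f p + g q = top") (auto simp: less_top intro: INF_lower2)
  have le': "?L \<le> f p + (INF q\<in>B. g q)" if "p \<in> A" for p
  proof (cases "f p = top")
    case False
    \<comment> \<open>Subtracting a finite summand is adjoint to adding it, so the bound for each
      \<open>q\<close> becomes a lower bound of all \<open>g q\<close> and passes to their
      infimum.\<close>
    then have "?L - f p \<le> (INF q\<in>B. g q)"
      using le[OF that] by (intro INF_greatest) (simp add: ennreal_minus_le_iff)
    then show ?thesis using False by (simp add: ennreal_minus_le_iff)
  qed simp
  show ?thesis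
  proof (cases "(INF q\<in>B. g q) = top")
    case False
    have "?L - (INF q\<in>B. g q) \<le> (INF p\<in>A. f p)"
    proof (rule INF_greatest)
      fix p assume "p \<in> A"
      then show "?L - (INF q\<in>B. g q) \<le> f p"
        using le' False unfolding ennreal_minus_le_iff by (metis add.commute)
    qed
    then show ?thesis using False unfolding ennreal_minus_le_iff by (simp only: add.commute)
  qed simp
qed

section \<open>Label distance and label addition\<close>

text \<open>For finite bounds the difference is additive, and clipping at 0 only enlarges the right
  side. Otherwise the two sums agree and the left side is 0, or the left side is -\<infinity>, or a
  summand on the right is \<infinity>. The two alternatives in the assumption describe the upper and
  the lower ends of intervals: the former are never -\<infinity>, the latter never
  \<infinity>.\<close>

lemma bound_diff_add_le:
  assumes "(u1 \<noteq> \<infinity> \<and> u2 \<noteq> \<infinity> \<and> v1 \<noteq> \<infinity> \<and> v2 \<noteq> \<infinity>) \<or>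
    (u1 \<noteq> -\<infinity> \<and> u2 \<noteq> -\<infinity> \<and> v1 \<noteq> -\<infinity> \<and> v2 \<noteq> -\<infinity>)"
  shows "bound_diff (u1 + u2) (v1 + v2) \<le> max (bound_diff u1 v1) 0 + max (bound_diff u2 v2) 0"
proof -
  have fin: "bound_diff (ereal a) (ereal b) = ereal (a - b)" for a b
    by (simp add: bound_diff_def)
  show ?thesis
    using assms
    by (cases u1; cases u2; cases v1; cases v2)
      (simp_all add: fin zero_ereal_def, simp_all add: bound_diff_def zero_ereal_def max_def)
qed

lemma e2ennreal_add:
  assumes "0 \<le> a" "0 \<le> b"
  shows "e2ennreal (a + b) = e2ennreal a + e2ennreal b"
  using assms
  by (simp add: enn2ereal_inject[symmetric] plus_ennreal.rep_eq enn2ereal_e2ennreal)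

lemma labels_bounds:
  "(a, (x, y)) \<in> labels \<Sigma> \<Longrightarrow> x \<noteq> \<infinity> \<and> y \<noteq> -\<infinity>"
  by (auto simp: labels_def intervals_def)

text \<open>Finite distance forces equal actions, and whether \<open>\<oplus>\<^sub>K\<close> is
  defined depends on the actions alone. The bound holds for lower and upper ends separately, and a
  maximum of sums is at most the sum of the maxima.\<close>

lemma label_plus_defined_dist_le:
  assumes lab: "k1 \<in> labels \<Sigma>" "k2 \<in> labels \<Sigma>" "k3 \<in> labels \<Sigma>" "k4 \<in> labels \<Sigma>"
    and fin: "label_dist k1 k2 < top" "label_dist k3 k4 < top"
  shows "k1 \<oplus>\<^sub>K k3 = None \<longleftrightarrow> k2 \<oplus>\<^sub>K k4 = None"
    and "k1 \<oplus>\<^sub>K k3 = Some k \<Longrightarrow> k2 \<oplus>\<^sub>K k4 = Some k' \<Longrightarrow>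
      label_dist k k' \<le> label_dist k1 k2 + label_dist k3 k4"
proof -
  obtain a1 x1 y1 where k1: "k1 = (a1, (x1, y1))" by (cases k1) auto
  obtain a2 x2 y2 where k2: "k2 = (a2, (x2, y2))" by (cases k2) auto
  obtain a3 x3 y3 where k3: "k3 = (a3, (x3, y3))" by (cases k3) auto
  obtain a4 x4 y4 where k4: "k4 = (a4, (x4, y4))" by (cases k4) auto
  have eq: "a1 = a2" "a3 = a4"
    using fin by (auto simp: k1 k2 k3 k4 split: if_splits)
  show "k1 \<oplus>\<^sub>K k3 = None \<longleftrightarrow> k2 \<oplus>\<^sub>K k4 = None" by (simp add: k1 k2 k3 k4 eq)
  \<comment> \<open>The estimate is made in \<open>ereal\<close>, where differences may be negative;
    the outer maximum with 0 makes \<open>?d\<close> nonnegative, so that \<open>e2ennreal\<close>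
    is additive on it.\<close>
  let ?d = "\<lambda>x y x' y'. max (max (bound_diff x' x) (bound_diff y y')) 0"
  have bounds: "x1 \<noteq> \<infinity>" "x2 \<noteq> \<infinity>" "x3 \<noteq> \<infinity>" "x4 \<noteq> \<infinity>"
    "y1 \<noteq> -\<infinity>" "y2 \<noteq> -\<infinity>" "y3 \<noteq> -\<infinity>" "y4 \<noteq> -\<infinity>"
    using lab unfolding k1 k2 k3 k4 by (auto dest!: labels_bounds)
  \<comment> \<open>Lower ends satisfy the first alternative of \<open>bound_diff_add_le\<close>,
    upper ends the second. The roles of the two labels are exchanged between them, as interval
    inclusion reverses the order of lower ends.\<close>
  have "bound_diff (x2 + x4) (x1 + x3) \<le> max (bound_diff x2 x1) 0 + max (bound_diff x4 x3) 0"
    "bound_diff (y1 + y3) (y2 + y4) \<le> max (bound_diff y1 y2) 0 + max (bound_diff y3 y4) 0"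
    using bounds by (intro bound_diff_add_le; blast)+
  moreover have "max (bound_diff x2 x1) 0 + max (bound_diff x4 x3) 0 \<le>
      ?d x1 y1 x2 y2 + ?d x3 y3 x4 y4"
    "max (bound_diff y1 y2) 0 + max (bound_diff y3 y4) 0 \<le> ?d x1 y1 x2 y2 + ?d x3 y3 x4 y4"
    by (intro add_mono; simp add: max.coboundedI1 max.coboundedI2)+
  ultimately have "?d (x1 + x3) (y1 + y3) (x2 + x4) (y2 + y4) \<le> ?d x1 y1 x2 y2 + ?d x3 y3 x4 y4"
    by (intro max.boundedI) (blast intro: order_trans, blast intro: order_trans, simp)
  then have "e2ennreal (?d (x1 + x3) (y1 + y3) (x2 + x4) (y2 + y4)) \<le>
      e2ennreal (?d x1 y1 x2 y2 + ?d x3 y3 x4 y4)"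
    by (rule e2ennreal_mono)
  also have "\<dots> = e2ennreal (?d x1 y1 x2 y2) + e2ennreal (?d x3 y3 x4 y4)"
    by (rule e2ennreal_add) auto
  finally show "label_dist k k' \<le> label_dist k1 k2 + label_dist k3 k4"
    if "k1 \<oplus>\<^sub>K k3 = Some k" "k2 \<oplus>\<^sub>K k4 = Some k'"
    using that by (auto simp: k1 k2 k3 k4 eq split: if_splits)
qed

text \<open>Shaped to discharge the premise of \<open>INF_le_INF_add_INF\<close>: \<open>fin\<close>
  is the finiteness available there, and distributivity collects the discounted successor distances
  into \<open>c * (d + e)\<close>. The first part extends a match from left to right, as for
  may-transitions, the second from right to left, as for must-transitions.\<close>

lemma label_plus_match:
  assumes lab: "k1 \<in> labels \<Sigma>" "k2 \<in> labels \<Sigma>" "k3 \<in> labels \<Sigma>" "k4 \<in> labels \<Sigma>"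
    and fin: "(label_dist k1 k2 + c * d) + (label_dist k3 k4 + c * e) < top"
  shows "k1 \<oplus>\<^sub>K k3 = Some k \<Longrightarrow> \<exists>k'. k2 \<oplus>\<^sub>K k4 = Some k' \<and>
      label_dist k k' + c * (d + e) \<le> (label_dist k1 k2 + c * d) + (label_dist k3 k4 + c * e)"
    and "k2 \<oplus>\<^sub>K k4 = Some k' \<Longrightarrow> \<exists>k. k1 \<oplus>\<^sub>K k3 = Some k \<and>
      label_dist k k' + c * (d + e) \<le> (label_dist k1 k2 + c * d) + (label_dist k3 k4 + c * e)"
proof -
  have "label_dist k1 k2 < top" "label_dist k3 k4 < top"
    using fin by (auto simp: ennreal_add_less_top)
  note plus = label_plus_defined_dist_le[OF lab this]
  have "label_dist k k' + c * (d + e) \<le> (label_dist k1 k2 + c * d) + (label_dist k3 k4 + c * e)"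
    if "k1 \<oplus>\<^sub>K k3 = Some k" "k2 \<oplus>\<^sub>K k4 = Some k'" for k k'
    using add_right_mono[OF plus(2)[OF that], of "c * (d + e)"]
    by (simp add: algebra_simps)
  with plus(1) show "k1 \<oplus>\<^sub>K k3 = Some k \<Longrightarrow> \<exists>k'. k2 \<oplus>\<^sub>K k4 = Some k' \<and>
      label_dist k k' + c * (d + e) \<le> (label_dist k1 k2 + c * d) + (label_dist k3 k4 + c * e)"
    and "k2 \<oplus>\<^sub>K k4 = Some k' \<Longrightarrow> \<exists>k. k1 \<oplus>\<^sub>K k3 = Some k \<and>
      label_dist k k' + c * (d + e) \<le> (label_dist k1 k2 + c * d) + (label_dist k3 k4 + c * e)"
    by (metis option.exhaust option.distinct(1))+
qed

section \<open>Transitions of compositions and the refinement operator\<close>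

lemma may_structural_comp:
  "((s1, s2), k, (t1, t2)) \<in> may (S1 \<parallel> S2) \<longleftrightarrow>
    (\<exists>k1 k2. (s1, k1, t1) \<in> may S1 \<and> (s2, k2, t2) \<in> may S2 \<and> k1 \<oplus>\<^sub>K k2 = Some k)"
  \<comment> \<open>Without the deletion, the quantified labels would be split into action and
    interval ends.\<close>
  by (simp add: structural_comp_def del: split_paired_Ex)

lemma must_structural_comp:
  "((s1, s2), k, (t1, t2)) \<in> must (S1 \<parallel> S2) \<longleftrightarrow>
    (\<exists>k1 k2. (s1, k1, t1) \<in> must S1 \<and> (s2, k2, t2) \<in> must S2 \<and> k1 \<oplus>\<^sub>K k2 = Some k)"
  by (simp add: structural_comp_def del: split_paired_Ex)

lemma init_structural_comp [simp]: "init (S1 \<parallel> S2) = (init S1, init S2)"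
  by (simp add: structural_comp_def)

lemma is_wmts_labels:
  assumes "is_wmts \<Sigma> S"
  shows "(s, k, t) \<in> may S \<Longrightarrow> k \<in> labels \<Sigma>" and "(s, k, t) \<in> must S \<Longrightarrow> k \<in> labels \<Sigma>"
  using assms by (auto simp: is_wmts_def)

lemma refine_step_may_ge:
  assumes "(s1, k1, t1) \<in> may S1"
  shows "(INF (k2, t2) \<in> {(k, t). (s2, k, t) \<in> may S2}. label_dist k1 k2 + ennreal lam * d t1 t2) \<le>
    refine_step lam S1 S2 d s1 s2"
  unfolding refine_step_def
  by (rule max.coboundedI1, rule SUP_upper2[of "(k1, t1)"]) (use assms in simp_all)

lemma refine_step_must_ge:
  assumes "(s2, k2, t2) \<in> must S2"
  shows "(INF (k1, t1) \<in> {(k, t). (s1, k, t) \<in> must S1}. label_dist k1 k2 + ennreal lam * d t1 t2) \<le>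
    refine_step lam S1 S2 d s1 s2"
  unfolding refine_step_def
  by (rule max.coboundedI2, rule SUP_upper2[of "(k2, t2)"]) (use assms in simp_all)

lemma refine_step_leI:
  assumes "\<And>k1 t1. (s1, k1, t1) \<in> may S1 \<Longrightarrow>
      (INF (k2, t2) \<in> {(k, t). (s2, k, t) \<in> may S2}. label_dist k1 k2 + ennreal lam * d t1 t2) \<le> c"
    and "\<And>k2 t2. (s2, k2, t2) \<in> must S2 \<Longrightarrow>
      (INF (k1, t1) \<in> {(k, t). (s1, k, t) \<in> must S1}. label_dist k1 k2 + ennreal lam * d t1 t2) \<le> c"
  shows "refine_step lam S1 S2 d s1 s2 \<le> c"
  unfolding refine_step_def
  by (intro max.boundedI SUP_least; clarify; rule assms)

text \<open>A transition of a composition splits into one transition per component; any two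
  component answers of finite total cost recombine to an answer of the other composition at no
  greater cost. The functions \<open>d\<close> and \<open>e\<close> are arbitrary, as only one
  application of the operator is involved.\<close>

lemma refine_step_structural_comp_le:
  fixes d :: "'s1 \<Rightarrow> 's2 \<Rightarrow> ennreal" and e :: "'s3 \<Rightarrow> 's4 \<Rightarrow> ennreal"
  assumes "is_wmts \<Sigma> S1" "is_wmts \<Sigma> S2" "is_wmts \<Sigma> S3" "is_wmts \<Sigma> S4"
  shows "refine_step lam (S1 \<parallel> S3) (S2 \<parallel> S4)
      (\<lambda>(t1, t3) (t2, t4). d t1 t2 + e t3 t4) (s1, s3) (s2, s4) \<le>
    refine_step lam S1 S2 d s1 s2 + refine_step lam S3 S4 e s3 s4"
    (is "refine_step _ _ _ ?D _ _ \<le> _")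
proof -
  note labs = assms[THEN is_wmts_labels(1)] assms[THEN is_wmts_labels(2)]
  have may_le: "(INF (k2, t2) \<in> {(k, t). ((s2, s4), k, t) \<in> may (S2 \<parallel> S4)}.
        label_dist k k2 + ennreal lam * ?D (t1, t3) t2) \<le>
      refine_step lam S1 S2 d s1 s2 + refine_step lam S3 S4 e s3 s4" (is "?L \<le> ?R")
    if "((s1, s3), k, (t1, t3)) \<in> may (S1 \<parallel> S3)" for k t1 t3
  proof -
    from that obtain k1 k3 where
      tr: "(s1, k1, t1) \<in> may S1" "(s3, k3, t3) \<in> may S3" and k: "k1 \<oplus>\<^sub>K k3 = Some k"
      unfolding may_structural_comp by blast
    have "?L \<le>
        (INF (k2, t2) \<in> {(k, t). (s2, k, t) \<in> may S2}. label_dist k1 k2 + ennreal lam * d t1 t2) +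
        (INF (k4, t4) \<in> {(k, t). (s4, k, t) \<in> may S4}. label_dist k3 k4 + ennreal lam * e t3 t4)"
    proof (rule INF_le_INF_add_INF)
      fix p q
      assume p: "p \<in> {(k, t). (s2, k, t) \<in> may S2}" and q: "q \<in> {(k, t). (s4, k, t) \<in> may S4}"
        and fin: "(case p of (k2, t2) \<Rightarrow> label_dist k1 k2 + ennreal lam * d t1 t2) +
          (case q of (k4, t4) \<Rightarrow> label_dist k3 k4 + ennreal lam * e t3 t4) < top"
      obtain k2 t2 k4 t4 where pq: "p = (k2, t2)" "q = (k4, t4)"
        by (cases p; cases q)
      have tr': "(s2, k2, t2) \<in> may S2" "(s4, k4, t4) \<in> may S4"
        using p q by (simp_all add: pq)
      have lab: "k1 \<in> labels \<Sigma>" "k2 \<in> labels \<Sigma>" "k3 \<in> labels \<Sigma>" "k4 \<in> labels \<Sigma>"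
        using tr tr' by (blast intro: labs)+
      obtain k' where k': "k2 \<oplus>\<^sub>K k4 = Some k'" and
        le: "label_dist k k' + ennreal lam * (d t1 t2 + e t3 t4) \<le>
          label_dist k1 k2 + ennreal lam * d t1 t2 + (label_dist k3 k4 + ennreal lam * e t3 t4)"
        \<comment> \<open>Finiteness of the total cost makes the actions agree, so the labels of the
          two answers can be added.\<close>
        using label_plus_match(1)[OF lab fin[unfolded pq split_conv] k] by blast
      have "((s2, s4), k', (t2, t4)) \<in> may (S2 \<parallel> S4)"
        unfolding may_structural_comp using tr' k' by blast
      with le show "\<exists>r\<in>{(k, t). ((s2, s4), k, t) \<in> may (S2 \<parallel> S4)}.
          (case r of (k', t) \<Rightarrow> label_dist k k' + ennreal lam * ?D (t1, t3) t) \<le>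
          (case p of (k2, t2) \<Rightarrow> label_dist k1 k2 + ennreal lam * d t1 t2) +
          (case q of (k4, t4) \<Rightarrow> label_dist k3 k4 + ennreal lam * e t3 t4)"
        by (intro bexI[of _ "(k', (t2, t4))"]) (simp_all add: pq)
    qed
    also have "\<dots> \<le> ?R"
      using tr by (intro add_mono refine_step_may_ge)
    finally show ?thesis .
  qed
  \<comment> \<open>For must-transitions the challenge comes from \<open>S2 \<parallel> S4\<close>
    and the answer from \<open>S1 \<parallel> S3\<close>, so the match runs backwards through
    \<open>label_plus_match(2)\<close>.\<close>
  have must_le: "(INF (k1, t1) \<in> {(k, t). ((s1, s3), k, t) \<in> must (S1 \<parallel> S3)}.
        label_dist k1 k + ennreal lam * ?D t1 (t2, t4)) \<le>
      refine_step lam S1 S2 d s1 s2 + refine_step lam S3 S4 e s3 s4" (is "?L \<le> ?R")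
    if "((s2, s4), k, (t2, t4)) \<in> must (S2 \<parallel> S4)" for k t2 t4
  proof -
    from that obtain k2 k4 where
      tr: "(s2, k2, t2) \<in> must S2" "(s4, k4, t4) \<in> must S4" and k: "k2 \<oplus>\<^sub>K k4 = Some k"
      unfolding must_structural_comp by blast
    have "?L \<le>
        (INF (k1, t1) \<in> {(k, t). (s1, k, t) \<in> must S1}. label_dist k1 k2 + ennreal lam * d t1 t2) +
        (INF (k3, t3) \<in> {(k, t). (s3, k, t) \<in> must S3}. label_dist k3 k4 + ennreal lam * e t3 t4)"
    proof (rule INF_le_INF_add_INF)
      fix p q
      assume p: "p \<in> {(k, t). (s1, k, t) \<in> must S1}" and q: "q \<in> {(k, t). (s3, k, t) \<in> must S3}"
        and fin: "(case p of (k1, t1) \<Rightarrow> label_dist k1 k2 + ennreal lam * d t1 t2) +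
          (case q of (k3, t3) \<Rightarrow> label_dist k3 k4 + ennreal lam * e t3 t4) < top"
      obtain k1 t1 k3 t3 where pq: "p = (k1, t1)" "q = (k3, t3)"
        by (cases p; cases q)
      have tr': "(s1, k1, t1) \<in> must S1" "(s3, k3, t3) \<in> must S3"
        using p q by (simp_all add: pq)
      have lab: "k1 \<in> labels \<Sigma>" "k2 \<in> labels \<Sigma>" "k3 \<in> labels \<Sigma>" "k4 \<in> labels \<Sigma>"
        using tr tr' by (blast intro: labs)+
      obtain k' where k': "k1 \<oplus>\<^sub>K k3 = Some k'" and
        le: "label_dist k' k + ennreal lam * (d t1 t2 + e t3 t4) \<le>
          label_dist k1 k2 + ennreal lam * d t1 t2 + (label_dist k3 k4 + ennreal lam * e t3 t4)"
        using label_plus_match(2)[OF lab fin[unfolded pq split_conv] k] by blast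
      have "((s1, s3), k', (t1, t3)) \<in> must (S1 \<parallel> S3)"
        unfolding must_structural_comp using tr' k' by blast
      with le show "\<exists>r\<in>{(k, t). ((s1, s3), k, t) \<in> must (S1 \<parallel> S3)}.
          (case r of (k', t) \<Rightarrow> label_dist k' k + ennreal lam * ?D t (t2, t4)) \<le>
          (case p of (k1, t1) \<Rightarrow> label_dist k1 k2 + ennreal lam * d t1 t2) +
          (case q of (k3, t3) \<Rightarrow> label_dist k3 k4 + ennreal lam * e t3 t4)"
        by (intro bexI[of _ "(k', (t1, t3))"]) (simp_all add: pq)
    qed
    also have "\<dots> \<le> ?R"
      using tr by (intro add_mono refine_step_must_ge)
    finally show ?thesis .
  qed
  show ?thesis
  proof (rule refine_step_leI)
    fix k and t :: "'s1 \<times> 's3"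
    assume "((s1, s3), k, t) \<in> may (S1 \<parallel> S3)"
    then show "(INF (k2, t2) \<in> {(k, t). ((s2, s4), k, t) \<in> may (S2 \<parallel> S4)}.
        label_dist k k2 + ennreal lam * ?D t t2) \<le>
      refine_step lam S1 S2 d s1 s2 + refine_step lam S3 S4 e s3 s4"
      using may_le by (cases t) blast
  next
    fix k and t :: "'s2 \<times> 's4"
    assume "((s2, s4), k, t) \<in> must (S2 \<parallel> S4)"
    then show "(INF (k1, t1) \<in> {(k, t). ((s1, s3), k, t) \<in> must (S1 \<parallel> S3)}.
        label_dist k1 k + ennreal lam * ?D t1 t) \<le>
      refine_step lam S1 S2 d s1 s2 + refine_step lam S3 S4 e s3 s4"
      using must_le by (cases t) blast
  qed
qed

section \<open>Passage to the least fixed point\<close>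

lemma state_dist_structural_comp_le:
  assumes "is_wmts \<Sigma> S1" "is_wmts \<Sigma> S2" "is_wmts \<Sigma> S3" "is_wmts \<Sigma> S4"
  shows "state_dist lam (S1 \<parallel> S3) (S2 \<parallel> S4) (s1, s3) (s2, s4) \<le>
    state_dist lam S1 S2 s1 s2 + state_dist lam S3 S4 s3 s4"
proof -
  let ?D = "\<lambda>(t1, t3) (t2, t4). state_dist lam S1 S2 t1 t2 + state_dist lam S3 S4 t3 t4"
  \<comment> \<open>The component distances are fixed points of their own operators, so the two
    operator terms on the right fold back into \<open>?D\<close>.\<close>
  have "refine_step lam (S1 \<parallel> S3) (S2 \<parallel> S4) ?D (s1, s3) (s2, s4) \<le> ?D (s1, s3) (s2, s4)"
    for s1 s2 s3 s4
    using refine_step_structural_comp_le[OF assms, of lam "state_dist lam S1 S2" "state_dist lam S3 S4"]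
    by (simp add: state_dist_unfold)
  then have "refine_step lam (S1 \<parallel> S3) (S2 \<parallel> S4) ?D \<le> ?D"
    by (intro le_funI) (metis surj_pair)
  then have "state_dist lam (S1 \<parallel> S3) (S2 \<parallel> S4) \<le> ?D"
    \<comment> \<open>The instantiation unfolds only the distance of the compositions and leaves
      those inside \<open>?D\<close> intact.\<close>
    unfolding state_dist_def[of lam "S1 \<parallel> S3"] by (rule lfp_lowerbound)
  then show ?thesis by (auto simp: le_fun_def)
qed

theorem theorem6:
  fixes \<Sigma> :: "'a set"
    and lam :: real
    and S1 :: "('a, 's1) wmts" and S2 :: "('a, 's2) wmts"
    and S3 :: "('a, 's3) wmts" and S4 :: "('a, 's4) wmts"
  assumes "finite \<Sigma>" and "0 < lam" and "lam < 1"
    and "is_wmts \<Sigma> S1" and "is_wmts \<Sigma> S2" and "is_wmts \<Sigma> S3" and "is_wmts \<Sigma> S4"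
    and "compactly_branching \<Sigma> lam S1" and "compactly_branching \<Sigma> lam S2"
    and "compactly_branching \<Sigma> lam S3" and "compactly_branching \<Sigma> lam S4"
  shows "modal_dist lam (S1 \<parallel> S3) (S2 \<parallel> S4) \<le> modal_dist lam S1 S2 + modal_dist lam S3 S4"
  unfolding modal_dist_def init_structural_comp
  using assms(4-7) by (rule state_dist_structural_comp_le)

end
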